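(* Let $n\ge 1$ and let $f:\mathbb{R}^n\to\mathbb{R}$ be a radial Cohn–Elkies function, with $r:=r(f)=R(n)$. Let $S\subseteq\mathbb{R}^n$ be a compact set with Lebesgue measure $\mu(S)>1$. Then: (1) there exists $z\in (S-S)$ with $\|z\|\ge r$ and $f(z)=0$; (2) there exists $z'\in S-S$ with $\hat f(z')=0$.
   Context: The Fourier transform is normalized as $\hat f(\xi)=\int_{\mathbb{R}^n} f(x)e^{-2\pi i \xi\cdot x}\,dx$. A function $f:\mathbb{R}^n\to\mathbb{R}$ is called acceptable if it is even and $f,\hat f\in L^1(\mathbb{R}^n)$ (so $f,\hat f$ are continuous). $\mathcal{F}_n$ denotes the set of acceptable $f:\mathbb{R}^n\to\mathbb{R}$ with $f(0)=\hat f(0)>0$, $\hat f(\xi)\ge 0$ for all $\xi$, and such that there is some $r>0$ with $f(x)\le 0$ whenever $\|x\|\ge r$. For $f\in\mathcal{F}_n$, $r(f):=\inf\{r\in\mathbb{R}: f(x)\le 0 \text{ for all } \|x\|\ge r\}$, and $R(n):=\inf_{f\in\mathcal{F}_n} r(f)$. A Cohn–Elkies function is an $f\in\mathcal{F}_n$ with $r(f)=R(n)$. A function is radial if $f(x)$ depends only on $\|x\|$. For $A,B\subseteq\mathbb{R}^n$, $A-B:=\{a-b: a\in A, b\in B\}$; $\mu$ is Lebesgue measure. *)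

theory Defs
  imports "HOL-Analysis.Analysis"
begin

definition fourier :: "('a::euclidean_space \<Rightarrow> real) \<Rightarrow> 'a \<Rightarrow> complex" where
  "fourier f \<xi> = (LINT x|lebesgue. complex_of_real (f x) * exp (- (2 * of_real pi * \<i> * of_real (\<xi> \<bullet> x))))"

text \<open>Acceptable: even, f and hat f in L1; by the paper's convention f (and hat f) are continuous.\<close>
definition acceptable :: "('a::euclidean_space \<Rightarrow> real) \<Rightarrow> bool" where
  "acceptable f \<longleftrightarrow> (\<forall>x. f (- x) = f x) \<and> continuous_on UNIV f \<and>
     integrable lebesgue f \<and> integrable lebesgue (fourier f)"

definition CE_class :: "('a::euclidean_space \<Rightarrow> real) set" where
  "CE_class = {f. acceptable f \<and> complex_of_real (f 0) = fourier f 0 \<and> f 0 > 0 \<and>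
      (\<forall>\<xi>. fourier f \<xi> \<in> \<real> \<and> Re (fourier f \<xi>) \<ge> 0) \<and>
      (\<exists>r>0. \<forall>x. norm x \<ge> r \<longrightarrow> f x \<le> 0)}"

definition r_of :: "('a::euclidean_space \<Rightarrow> real) \<Rightarrow> real" where
  "r_of f = Inf {r. \<forall>x. norm x \<ge> r \<longrightarrow> f x \<le> 0}"

definition R_dim :: "'a::euclidean_space itself \<Rightarrow> real" where
  "R_dim _ = Inf (r_of ` (CE_class :: ('a \<Rightarrow> real) set))"

definition cohn_elkies :: "('a::euclidean_space \<Rightarrow> real) \<Rightarrow> bool" where
  "cohn_elkies f \<longleftrightarrow> f \<in> CE_class \<and> r_of f = R_dim TYPE('a)"

definition radial :: "('a::real_normed_vector \<Rightarrow> 'b) \<Rightarrow> bool" where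
  "radial f \<longleftrightarrow> (\<forall>x y. norm x = norm y \<longrightarrow> f x = f y)"

end

theory Submission
  imports Defs "HOL-Probability.Probability"
begin

text \<open>Let \<open>g\<close> be the autocorrelation of the indicator of \<open>S\<close>. It is supported in \<open>S - S\<close>, has
  nonnegative transform \<open>|1_S^|^2\<close>, and \<open>g^(0) = \<mu>(S)^2 > \<mu>(S) = g(0)\<close>. If \<open>f\<close> had no zero
  of norm at least \<open>r\<close> in \<open>S - S\<close>, then \<open>f + \<epsilon>g\<close> would still be nonpositive beyond \<open>r\<close> for small
  \<open>\<epsilon>\<close>; if \<open>f^\<close> had no zero in \<open>S - S\<close>, then \<open>f - \<epsilon>g^\<close> would still have nonnegative transform
  \<open>f^ - \<epsilon>g\<close>. In both cases the perturbation \<open>h\<close> satisfies \<open>h^(0) > h(0)\<close>, so a dilation of it lies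
  in the Cohn--Elkies class with a radius smaller than the optimal \<open>r\<close>. Integrability of \<open>g^\<close> and
  Fourier inversion for \<open>g\<close> come from Gaussian regularisation, using \<open>g^ \<ge> 0\<close>.\<close>

section \<open>The Fourier transform and Gaussians\<close>

lemma lborel_integral_affine:
  fixes f :: "'a::euclidean_space \<Rightarrow> 'b::{banach, second_countable_topology}"
  assumes [measurable]: "f \<in> borel_measurable borel" and c: "c \<noteq> 0"
  shows "integral\<^sup>L lborel f = \<bar>c\<bar> ^ DIM('a) *\<^sub>R (LINT x|lborel. f (t + c *\<^sub>R x))"
  by (subst lborel_affine[OF c, of t]) (simp add: integral_density integral_distr)

lemma lborel_integrable_affine_iff:
  fixes f :: "'a::euclidean_space \<Rightarrow> 'b::{banach, second_countable_topology}"
  assumes [measurable]: "f \<in> borel_measurable borel" and c: "c \<noteq> 0"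
  shows "integrable lborel (\<lambda>x. f (t + c *\<^sub>R x)) \<longleftrightarrow> integrable lborel f"
proof -
  have "integrable lborel f
      \<longleftrightarrow> integrable (density (distr lborel borel (\<lambda>x. t + c *\<^sub>R x)) (\<lambda>_. \<bar>c\<bar> ^ DIM('a))) f"
    using lborel_affine[OF c, of t] by simp
  also have "\<dots> \<longleftrightarrow> integrable lborel (\<lambda>x. f (t + c *\<^sub>R x))"
  proof -
    have "integrable lborel (\<lambda>x. \<bar>c\<bar> ^ DIM('a) *\<^sub>R f (t + c *\<^sub>R x)) \<longleftrightarrow> integrable lborel (\<lambda>x. f (t + c *\<^sub>R x))"
      using c integrable_scaleR_right[of "inverse (\<bar>c\<bar> ^ DIM('a))" lborel "\<lambda>x. \<bar>c\<bar> ^ DIM('a) *\<^sub>R f (t + c *\<^sub>R x)"]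
      by auto
    then show ?thesis
      by (subst integrable_density) (auto simp: integrable_distr_eq)
  qed
  finally show ?thesis ..
qed

lemma continuous_on_cis_real [continuous_intros]:
  "continuous_on A g \<Longrightarrow> continuous_on A (\<lambda>x. cis (g x))"
  unfolding cis_conv_exp by (intro continuous_intros)

lemma borel_measurable_cis [measurable (raw)]:
  "g \<in> borel_measurable M \<Longrightarrow> (\<lambda>x. cis (g x)) \<in> borel_measurable M"
  by (rule measurable_compose[OF _ borel_measurable_continuous_onI])
     (auto intro!: continuous_intros)

text \<open>Completing the measure does not change the integral of a Borel function. Over
  \<open>lborel\<close>, Fubini and product measures are at hand.\<close>

lemma fourier_eq_lborel:
  assumes [measurable]: "f \<in> borel_measurable borel"
  shows "fourier f \<xi> = (LINT x|lborel. of_real (f x) * cis (- (2 * pi * (\<xi> \<bullet> x))))"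
proof -
  have "exp (- (2 * of_real pi * \<i> * of_real t)) = cis (- (2 * pi * t))" for t
    by (simp add: cis_conv_exp mult_ac)
  then show ?thesis
    unfolding fourier_def by (simp add: integral_completion)
qed

text \<open>The factor \<open>cis\<close> has modulus 1, and integrability of a measurable function
  depends only on its norm.\<close>

lemma integrable_mult_cis_iff:
  assumes [measurable]: "f \<in> borel_measurable M" "g \<in> borel_measurable M"
  shows "integrable M (\<lambda>x. complex_of_real (f x) * cis (g x)) \<longleftrightarrow> integrable M f"
  by (subst (1 2) integrable_norm_iff[symmetric]) (auto simp: norm_mult)

lemma borel_measurable_fourier [measurable]:
  assumes [measurable]: "f \<in> borel_measurable borel"
  shows "fourier f \<in> borel_measurable borel"
  unfolding fourier_eq_lborel[OF assms] by measurable

text \<open>This is the characteristic function exp (- t^2 / 2) of the standard normal law,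
  rescaled: the substitution of sqrt (2 pi) x for x turns the density into exp (- pi x^2) / sqrt (2
  pi).\<close>

lemma gaussian_real_fourier:
  fixes t :: real
  shows "integrable lborel (\<lambda>x. exp (- pi * x\<^sup>2))"
    and "(LINT x|lborel. complex_of_real (exp (- pi * x\<^sup>2)) * cis (- (2 * pi * (t * x))))
           = of_real (exp (- pi * t\<^sup>2))"
proof -
  let ?s = "sqrt (2 * pi)"
  have s: "?s > 0" "?s\<^sup>2 = 2 * pi" by auto
  have sc: "std_normal_density (?s * x) = exp (- pi * x\<^sup>2) / ?s" for x
    by (simp add: std_normal_density_def power_mult_distrib)
  have "integrable lborel std_normal_density"
    by (rule integrable_normal_density) simp
  then have "integrable lborel (\<lambda>x. std_normal_density (0 + ?s * x))"
    by (rule lborel_integrable_real_affine) simp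
  then have "integrable lborel (\<lambda>x. ?s * (exp (- pi * x\<^sup>2) / ?s))"
    unfolding add_0 sc by (rule integrable_mult_right)
  then show "integrable lborel (\<lambda>x. exp (- pi * x\<^sup>2))"
    using s(1) by simp
  \<comment> \<open>The point \<open>- ?s * t\<close> is chosen so that (s t)^2 / 2 = pi t^2 and so
    that the later substitution of s x for x produces the phase - 2 pi t x.\<close>
  have "complex_of_real (exp (- pi * t\<^sup>2)) = char std_normal_distribution (- ?s * t)"
    by (simp add: char_std_normal_distribution power_mult_distrib)
  also have "\<dots> = (LINT x|lborel. std_normal_density x *\<^sub>R cis (- ?s * t * x))"
    by (simp add: char_def integral_density cis_conv_exp)
  also have "\<dots> = \<bar>?s\<bar> *\<^sub>R (LINT x|lborel. std_normal_density (0 + ?s * x) *\<^sub>R cis (- ?s * t * (0 + ?s * x)))"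
    by (rule lborel_integral_real_affine) simp
  also have "\<dots> = ?s *\<^sub>R (LINT x|lborel. std_normal_density (?s * x) *\<^sub>R cis (- (2 * pi * (t * x))))"
  proof -
    have "- ?s * t * (?s * x) = - (?s\<^sup>2 * (t * x))" for x
      unfolding power2_eq_square by (simp only: mult_ac mult_minus_left)
    then show ?thesis using s by (simp only: add_0 abs_of_pos)
  qed
  also have "\<dots> = (LINT x|lborel. ?s *\<^sub>R (std_normal_density (?s * x) *\<^sub>R cis (- (2 * pi * (t * x)))))"
    by (rule integral_scaleR_right[symmetric])
  also have "\<dots> = (LINT x|lborel. complex_of_real (exp (- pi * x\<^sup>2)) * cis (- (2 * pi * (t * x))))"
    unfolding sc using s(1) by (intro Bochner_Integration.integral_cong) (auto simp: scaleR_conv_of_real)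
  finally show "(LINT x|lborel. complex_of_real (exp (- pi * x\<^sup>2)) * cis (- (2 * pi * (t * x))))
           = of_real (exp (- pi * t\<^sup>2))" ..
qed

text \<open>Normalised so as to have integral 1 and to be its own Fourier transform.\<close>

definition gaussian :: "'a::euclidean_space \<Rightarrow> real" where
  "gaussian x = exp (- pi * (norm x)\<^sup>2)"

lemma continuous_on_gaussian: "continuous_on A gaussian"
  unfolding gaussian_def[abs_def] by (intro continuous_intros)

lemma borel_measurable_gaussian [measurable]: "gaussian \<in> borel_measurable borel"
  unfolding gaussian_def[abs_def] by measurable

lemma gaussian_bounds: "0 < gaussian x" "gaussian x \<le> 1"
  by (auto simp: gaussian_def)

lemma gaussian_0 [simp]: "gaussian 0 = 1"
  by (simp add: gaussian_def)

lemma prod_cis: "finite A \<Longrightarrow> (\<Prod>i\<in>A. cis (g i)) = cis (sum g A)"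
  by (induction A rule: finite_induct) (auto simp: cis_mult)

text \<open>Both the Gaussian and the phase factor over the coordinates, and \<open>lborel\<close>
  is the image of a product of real Lebesgue measures, so the one-dimensional formulas multiply
  up.\<close>

lemma
  fixes \<xi> :: "'a::euclidean_space"
  shows integrable_gaussian: "integrable lborel (gaussian :: 'a \<Rightarrow> real)"
    and fourier_gaussian: "fourier gaussian \<xi> = of_real (gaussian \<xi>)"
proof -
  interpret product_sigma_finite "\<lambda>_::'a. lborel :: real measure" ..
  let ?T = "\<lambda>f::'a \<Rightarrow> real. \<Sum>b\<in>Basis. f b *\<^sub>R b"
  let ?h = "\<lambda>b (y::real). complex_of_real (exp (- pi * y\<^sup>2)) * cis (- (2 * pi * ((\<xi> \<bullet> b) * y)))"
  have [measurable]: "?T \<in> (\<Pi>\<^sub>M b\<in>Basis. lborel) \<rightarrow>\<^sub>M borel" by measurable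
  have pt: "complex_of_real (gaussian (?T y)) * cis (- (2 * pi * (\<xi> \<bullet> ?T y))) = (\<Prod>b\<in>Basis. ?h b (y b))" for y
  proof -
    have "(norm (?T y))\<^sup>2 = (\<Sum>b\<in>Basis. (?T y \<bullet> b)\<^sup>2)"
      unfolding power2_norm_eq_inner by (subst euclidean_inner) (simp add: power2_eq_square)
    then have n: "(norm (?T y))\<^sup>2 = (\<Sum>b\<in>Basis. (y b)\<^sup>2)"
      by simp
    have "\<xi> \<bullet> ?T y = (\<Sum>b\<in>Basis. (\<xi> \<bullet> b) * y b)"
      by (simp add: inner_sum_right mult.commute)
    with n show ?thesis
      by (simp add: gaussian_def prod.distrib prod_cis sum_negf sum_distrib_left
            exp_sum[symmetric] flip: of_real_prod)
  qed
  have ih: "integrable lborel (?h b)" for b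
    using gaussian_real_fourier(1) by (subst integrable_mult_cis_iff) auto
  have "integrable (\<Pi>\<^sub>M b\<in>Basis. lborel) (\<lambda>y. \<Prod>b\<in>Basis. ?h b (y b))"
    by (rule product_integrable_prod) (use ih in auto)
  then have "integrable lborel (\<lambda>x. complex_of_real (gaussian x) * cis (- (2 * pi * (\<xi> \<bullet> x))))"
    unfolding pt[symmetric] by (subst lborel_eq) (simp add: integrable_distr_eq)
  then show "integrable lborel (gaussian :: 'a \<Rightarrow> real)"
    by (subst (asm) integrable_mult_cis_iff) auto
  have "fourier gaussian \<xi> = (\<integral>y. (\<Prod>b\<in>Basis. ?h b (y b)) \<partial>(\<Pi>\<^sub>M b\<in>Basis. lborel))"
    unfolding pt[symmetric]
    by (subst fourier_eq_lborel, simp, subst lborel_eq) (simp add: integral_distr)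
  also have "\<dots> = (\<Prod>b\<in>Basis. LINT x|lborel. ?h b x)"
    by (rule product_integral_prod) (use ih in auto)
  also have "\<dots> = (\<Prod>b\<in>Basis. complex_of_real (exp (- pi * (\<xi> \<bullet> b)\<^sup>2)))"
    unfolding gaussian_real_fourier(2) ..
  also have "\<dots> = of_real (gaussian \<xi>)"
  proof -
    have "(norm \<xi>)\<^sup>2 = (\<Sum>b\<in>Basis. (\<xi> \<bullet> b)\<^sup>2)"
      unfolding power2_norm_eq_inner by (subst euclidean_inner) (simp add: power2_eq_square)
    then show ?thesis
      by (simp add: gaussian_def sum_negf sum_distrib_left exp_sum[symmetric] flip: of_real_prod)
  qed
  finally show "fourier gaussian \<xi> = of_real (gaussian \<xi>)" .
qed

section \<open>Fourier inversion for nonnegative transforms\<close>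

lemma fourier_scale:
  fixes f :: "'a::euclidean_space \<Rightarrow> real"
  assumes [measurable]: "f \<in> borel_measurable borel" and c: "c \<noteq> 0"
  shows "fourier (\<lambda>x. f (c *\<^sub>R x)) \<xi> = fourier f (\<xi> /\<^sub>R c) / of_real (\<bar>c\<bar> ^ DIM('a))"
proof -
  have "fourier f (\<xi> /\<^sub>R c)
      = \<bar>c\<bar> ^ DIM('a) *\<^sub>R (LINT x|lborel. of_real (f (0 + c *\<^sub>R x)) * cis (- (2 * pi * ((\<xi> /\<^sub>R c) \<bullet> (0 + c *\<^sub>R x)))))"
    by (subst fourier_eq_lborel, simp, rule lborel_integral_affine) (use c in simp_all)
  also have "\<dots> = \<bar>c\<bar> ^ DIM('a) *\<^sub>R fourier (\<lambda>x. f (c *\<^sub>R x)) \<xi>"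
  proof -
    have "(\<xi> /\<^sub>R c) \<bullet> (0 + c *\<^sub>R x) = \<xi> \<bullet> x" for x
      using c by (simp add: field_simps)
    then show ?thesis
      by (simp only: add_0) (simp add: fourier_eq_lborel)
  qed
  finally show ?thesis
    using c by (simp add: scaleR_conv_of_real)
qed

lemma fourier_add_mult:
  assumes [measurable]: "f \<in> borel_measurable borel" "g \<in> borel_measurable borel"
    and "integrable lborel f" "integrable lborel g"
  shows "fourier (\<lambda>x. f x + c * g x) \<xi> = fourier f \<xi> + of_real c * fourier g \<xi>"
proof -
  have "integrable lborel (\<lambda>x. complex_of_real (f x) * cis (- (2 * pi * (\<xi> \<bullet> x))))"
    "integrable lborel (\<lambda>x. complex_of_real (g x) * cis (- (2 * pi * (\<xi> \<bullet> x))))"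
    using assms by (simp_all add: integrable_mult_cis_iff)
  then show ?thesis
    by (simp add: fourier_eq_lborel distrib_right mult.assoc)
qed

lemma fourier_0:
  assumes "f \<in> borel_measurable borel"
  shows "fourier f 0 = of_real (integral\<^sup>L lborel f)"
  using assms by (simp add: fourier_eq_lborel)

text \<open>Dominated convergence along sequences; |f| dominates every integrand because the phases
  have modulus 1.\<close>

lemma continuous_on_fourier:
  assumes [measurable]: "f \<in> borel_measurable borel" and f: "integrable lborel f"
  shows "continuous_on A (fourier f)"
proof -
  have "(\<lambda>n. fourier f (X n)) \<longlonglongrightarrow> fourier f \<xi>" if X: "X \<longlonglongrightarrow> \<xi>" for X \<xi>
    unfolding fourier_eq_lborel[OF assms(1)]
  proof (rule integral_dominated_convergence[where w = "\<lambda>x. \<bar>f x\<bar>"])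
    have "(\<lambda>n. cis (- (2 * pi * (X n \<bullet> x)))) \<longlonglongrightarrow> cis (- (2 * pi * (\<xi> \<bullet> x)))" for x
      unfolding cis_conv_exp by (intro tendsto_intros X)
    then show "AE x in lborel. (\<lambda>n. complex_of_real (f x) * cis (- (2 * pi * (X n \<bullet> x))))
        \<longlonglongrightarrow> of_real (f x) * cis (- (2 * pi * (\<xi> \<bullet> x)))"
      by (intro always_eventually allI tendsto_mult_left)
  qed (use f in \<open>auto simp: norm_mult\<close>)
  then have "continuous_on UNIV (fourier f)"
    by (simp add: continuous_on_sequentially o_def)
  then show ?thesis
    by (rule continuous_on_subset) simp
qed

lemma integrable_lborel_prod_mult:
  fixes a b :: "'a::euclidean_space \<Rightarrow> real"
  assumes [measurable]: "a \<in> borel_measurable borel" "b \<in> borel_measurable borel"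
    and a: "integrable lborel a" and b: "integrable lborel b"
  shows "integrable (lborel \<Otimes>\<^sub>M lborel) (\<lambda>(x, y). a x * b y)"
  by (rule lborel_pair.Fubini_integrable) (use a b in \<open>auto simp: abs_mult\<close>)

text \<open>The Gaussian factor makes the double integral absolutely convergent without
  integrability of \<open>fourier g\<close>. After Fubini, the inner integral is the transform of a
  dilated Gaussian at x + u, which averages g near - x.\<close>

lemma gaussian_regularised_inversion:
  fixes g :: "'a::euclidean_space \<Rightarrow> real"
  assumes [measurable]: "g \<in> borel_measurable borel"
    and g: "integrable lborel g" and e: "e > 0"
  shows "(LINT \<xi>|lborel. fourier g \<xi> * of_real (gaussian (e *\<^sub>R \<xi>)) * cis (- (2 * pi * (x \<bullet> \<xi>))))
       = of_real (LINT y|lborel. g (- x + e *\<^sub>R y) * gaussian y)" (is "?L = _")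
proof -
  let ?k = "\<lambda>\<xi> u. complex_of_real (g u * gaussian (e *\<^sub>R \<xi>)) * cis (- (2 * pi * ((x + u) \<bullet> \<xi>)))"
  \<comment> \<open>What remains after integrating over \<xi>: g(u) times the transform of
    \<open>\<lambda>\<xi>. gaussian (e *\<^sub>R \<xi>)\<close> at x + u.\<close>
  let ?F = "\<lambda>u. g u * (gaussian ((x + u) /\<^sub>R e) / e ^ DIM('a))"
  have "integrable lborel (\<lambda>\<xi>::'a. gaussian (0 + e *\<^sub>R \<xi>))"
    using e by (subst lborel_integrable_affine_iff) (auto intro: integrable_gaussian)
  then have "integrable (lborel \<Otimes>\<^sub>M lborel) (\<lambda>(\<xi>::'a, u). gaussian (e *\<^sub>R \<xi>) * g u)"
    using integrable_lborel_prod_mult[of "\<lambda>\<xi>. gaussian (e *\<^sub>R \<xi>)" g] g by simp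
  then have "integrable (lborel \<Otimes>\<^sub>M lborel) (\<lambda>p. complex_of_real (g (snd p) * gaussian (e *\<^sub>R fst p)) * cis (- (2 * pi * ((x + snd p) \<bullet> fst p))))"
    by (subst integrable_mult_cis_iff) (auto simp: case_prod_beta' mult.commute)
  then have int: "integrable (lborel \<Otimes>\<^sub>M lborel) (case_prod ?k)"
    by (simp add: case_prod_beta')
  have "?L = (LINT \<xi>|lborel. LINT u|lborel. ?k \<xi> u)"
  proof (rule Bochner_Integration.integral_cong[OF refl])
    fix \<xi> :: 'a
    have "fourier g \<xi> * of_real (gaussian (e *\<^sub>R \<xi>)) * cis (- (2 * pi * (x \<bullet> \<xi>)))
        = (LINT u|lborel. of_real (g u) * cis (- (2 * pi * (\<xi> \<bullet> u))) * (of_real (gaussian (e *\<^sub>R \<xi>)) * cis (- (2 * pi * (x \<bullet> \<xi>)))))"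
      by (simp only: integral_mult_left_zero fourier_eq_lborel[OF assms(1)] mult.assoc[of "integral\<^sup>L _ _"])
    also have "\<dots> = (LINT u|lborel. ?k \<xi> u)"
    proof (rule Bochner_Integration.integral_cong[OF refl])
      fix u
      have "cis (- (2 * pi * ((x + u) \<bullet> \<xi>))) = cis (- (2 * pi * (\<xi> \<bullet> u))) * cis (- (2 * pi * (x \<bullet> \<xi>)))"
        unfolding cis_mult by (simp add: inner_add_left inner_commute[of \<xi> u] algebra_simps)
      then show "of_real (g u) * cis (- (2 * pi * (\<xi> \<bullet> u))) * (of_real (gaussian (e *\<^sub>R \<xi>)) * cis (- (2 * pi * (x \<bullet> \<xi>)))) = ?k \<xi> u"
        by (simp add: mult_ac)
    qed
    finally show "fourier g \<xi> * of_real (gaussian (e *\<^sub>R \<xi>)) * cis (- (2 * pi * (x \<bullet> \<xi>))) = (LINT u|lborel. ?k \<xi> u)" .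
  qed
  also have "\<dots> = (LINT u|lborel. LINT \<xi>|lborel. ?k \<xi> u)"
    using lborel_pair.Fubini_integral[OF int] by simp
  also have "\<dots> = (LINT u|lborel. of_real (?F u))"
  proof (rule Bochner_Integration.integral_cong[OF refl])
    fix u :: 'a
    have "(LINT \<xi>|lborel. ?k \<xi> u) = of_real (g u) * fourier (\<lambda>\<xi>. gaussian (e *\<^sub>R \<xi>)) (x + u)"
      by (simp add: fourier_eq_lborel mult.assoc)
    also have "\<dots> = of_real (?F u)"
      using e by (subst fourier_scale) (auto simp: fourier_gaussian)
    finally show "(LINT \<xi>|lborel. ?k \<xi> u) = of_real (?F u)" .
  qed
  also have "\<dots> = of_real (LINT u|lborel. ?F u)"
    by (rule integral_complex_of_real)
  \<comment> \<open>Substituting u = - x + e y cancels the factor e^n and leaves the undilated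
    Gaussian as weight.\<close>
  also have "(LINT u|lborel. ?F u) = \<bar>e\<bar> ^ DIM('a) *\<^sub>R (LINT y|lborel. ?F (- x + e *\<^sub>R y))"
    by (rule lborel_integral_affine) (use e in auto)
  also have "\<dots> = (LINT y|lborel. g (- x + e *\<^sub>R y) * gaussian y)"
    using e by (simp add: field_simps)
  finally show ?thesis .
qed

text \<open>As the regularisation tends to 0, the Gaussian averages of the bounded continuous g tend
  to g(- x). Since the transform is nonnegative, monotone convergence at x = 0 yields its
  integrability; dominated convergence then gives inversion everywhere. Two forward transforms
  compose to a reflection, hence the sign in \<open>g (- x)\<close>.\<close>

lemma
  fixes g :: "'a::euclidean_space \<Rightarrow> real"
  assumes cont: "continuous_on UNIV g" and g: "integrable lborel g"
    and B: "\<And>x. \<bar>g x\<bar> \<le> B"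
    and real: "\<And>\<xi>. fourier g \<xi> \<in> \<real>" and nonneg: "\<And>\<xi>. 0 \<le> Re (fourier g \<xi>)"
  shows integrable_fourier_if_nonneg: "integrable lborel (\<lambda>\<xi>. Re (fourier g \<xi>))"
    and fourier_inversion_if_nonneg: "fourier (\<lambda>\<xi>. Re (fourier g \<xi>)) x = of_real (g (- x))"
proof -
  have [measurable]: "g \<in> borel_measurable borel"
    using cont by (rule borel_measurable_continuous_onI)
  let ?G = "\<lambda>\<xi>. Re (fourier g \<xi>)"
  let ?e = "\<lambda>k. inverse (real (Suc k))"
  have e0: "?e \<longlonglongrightarrow> 0" by (rule LIMSEQ_inverse_real_of_nat)
  have G: "fourier g \<xi> = of_real (?G \<xi>)" for \<xi>
    using real[of \<xi>] by (simp add: of_real_Re)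
  have reg: "(LINT \<xi>|lborel. complex_of_real (?G \<xi> * gaussian (?e k *\<^sub>R \<xi>)) * cis (- (2 * pi * (x \<bullet> \<xi>))))
       = of_real (LINT y|lborel. g (- x + ?e k *\<^sub>R y) * gaussian y)" for k x
    unfolding of_real_mult G[symmetric]
    using gaussian_regularised_inversion[of g "?e k" x] g by simp
  have "(LINT y|lborel. gaussian (y::'a)) = 1"
    using fourier_0[of "gaussian :: 'a \<Rightarrow> real"] by (simp add: fourier_gaussian)
  moreover have "(\<lambda>k. LINT y|lborel. g (- x + ?e k *\<^sub>R y) * gaussian y) \<longlonglongrightarrow> (LINT y|lborel. g (- x) * gaussian (y::'a))" for x
  proof (rule integral_dominated_convergence[where w = "\<lambda>y. B * gaussian y"])
    have "(\<lambda>k. g (- x + ?e k *\<^sub>R y)) \<longlonglongrightarrow> g (- x)" for y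
    proof -
      have "(\<lambda>k. - x + ?e k *\<^sub>R y) \<longlonglongrightarrow> - x + 0 *\<^sub>R y"
        by (intro tendsto_intros e0)
      then show ?thesis
        using continuous_on_tendsto_compose[OF cont, of "\<lambda>k. - x + ?e k *\<^sub>R y"] by simp
    qed
    then show "AE y in lborel. (\<lambda>k. g (- x + ?e k *\<^sub>R y) * gaussian y) \<longlonglongrightarrow> g (- x) * gaussian y"
      by (intro always_eventually allI tendsto_mult_right)
    show "AE y in lborel. norm (g (- x + ?e k *\<^sub>R y) * gaussian y) \<le> B * gaussian y" for k
      by (intro always_eventually allI)
         (simp add: abs_mult less_imp_le[OF gaussian_bounds(1)] B mult_right_mono)
  qed (auto intro: integrable_gaussian)
  ultimately have lim: "(\<lambda>k. LINT y|lborel. g (- x + ?e k *\<^sub>R y) * gaussian y) \<longlonglongrightarrow> g (- x)" for x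
    by simp
  have gl: "(\<lambda>k. gaussian (?e k *\<^sub>R \<xi>)) \<longlonglongrightarrow> 1" for \<xi> :: 'a
  proof -
    have "(\<lambda>k. ?e k *\<^sub>R \<xi>) \<longlonglongrightarrow> 0 *\<^sub>R \<xi>"
      by (intro tendsto_intros e0)
    then show ?thesis
      using continuous_on_tendsto_compose[OF continuous_on_gaussian[of UNIV], of "\<lambda>k. ?e k *\<^sub>R \<xi>" "0 *\<^sub>R \<xi>"] by simp
  qed
  \<comment> \<open>The L1 norm of g bounds its transform, so for each fixed k the product with a
    Gaussian is integrable.\<close>
  have Gb: "?G \<xi> \<le> integral\<^sup>L lborel (\<lambda>x. \<bar>g x\<bar>)" for \<xi>
  proof -
    have "?G \<xi> \<le> norm (fourier g \<xi>)" by (rule complex_Re_le_cmod)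
    also have "\<dots> \<le> (LINT x|lborel. norm (complex_of_real (g x) * cis (- (2 * pi * (\<xi> \<bullet> x)))))"
      by (subst fourier_eq_lborel) (auto intro: integral_norm_bound)
    finally show ?thesis by (simp add: norm_mult)
  qed
  show int: "integrable lborel ?G"
  proof (rule integrable_monotone_convergence[where f = "\<lambda>k \<xi>. ?G \<xi> * gaussian (?e k *\<^sub>R \<xi>)"])
    show "integrable lborel (\<lambda>\<xi>. ?G \<xi> * gaussian (?e k *\<^sub>R \<xi>))" for k
    proof (rule Bochner_Integration.integrable_bound)
      have "integrable lborel (\<lambda>\<xi>::'a. gaussian (0 + ?e k *\<^sub>R \<xi>))"
        by (subst lborel_integrable_affine_iff) (auto intro: integrable_gaussian)
      then show "integrable lborel (\<lambda>\<xi>::'a. integral\<^sup>L lborel (\<lambda>x. \<bar>g x\<bar>) * gaussian (?e k *\<^sub>R \<xi>))"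
        by simp
      show "AE \<xi> in lborel. norm (?G \<xi> * gaussian (?e k *\<^sub>R \<xi>))
          \<le> norm (integral\<^sup>L lborel (\<lambda>x. \<bar>g x\<bar>) * gaussian (?e k *\<^sub>R \<xi>))"
        using Gb nonneg
        by (intro always_eventually allI)
           (simp add: abs_mult less_imp_le[OF gaussian_bounds(1)] mult_right_mono)
    qed simp
    show "AE \<xi> in lborel. mono (\<lambda>k. ?G \<xi> * gaussian (?e k *\<^sub>R \<xi>))"
    proof (intro always_eventually allI monoI)
      fix \<xi> :: 'a and i j :: nat
      assume "i \<le> j"
      then have "?e j \<le> ?e i" by (simp add: field_simps)
      then have "gaussian (?e i *\<^sub>R \<xi>) \<le> gaussian (?e j *\<^sub>R \<xi>)"
        by (auto simp: gaussian_def intro!: power_mono mult_right_mono)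
      then show "?G \<xi> * gaussian (?e i *\<^sub>R \<xi>) \<le> ?G \<xi> * gaussian (?e j *\<^sub>R \<xi>)"
        using nonneg by (rule mult_left_mono)
    qed
    show "AE \<xi> in lborel. (\<lambda>k. ?G \<xi> * gaussian (?e k *\<^sub>R \<xi>)) \<longlonglongrightarrow> ?G \<xi>"
      using tendsto_mult_left[OF gl, of "?G \<xi>" \<xi> for \<xi>] by (intro always_eventually allI) simp
    \<comment> \<open>At x = 0 the phase is 1, and the regularised formula supplies the finite limit
      g(0) that monotone convergence requires.\<close>
    have "(LINT \<xi>|lborel. ?G \<xi> * gaussian (?e k *\<^sub>R \<xi>)) = (LINT y|lborel. g (- 0 + ?e k *\<^sub>R y) * gaussian y)" for k
      using reg[of k 0] by (simp del: of_real_mult add: integral_complex_of_real)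
    then show "(\<lambda>k. LINT \<xi>|lborel. ?G \<xi> * gaussian (?e k *\<^sub>R \<xi>)) \<longlonglongrightarrow> g (- 0)"
      using lim[of 0] by simp
  qed simp
  have "(\<lambda>k. LINT \<xi>|lborel. complex_of_real (?G \<xi> * gaussian (?e k *\<^sub>R \<xi>)) * cis (- (2 * pi * (x \<bullet> \<xi>))))
      \<longlonglongrightarrow> (LINT \<xi>|lborel. complex_of_real (?G \<xi>) * cis (- (2 * pi * (x \<bullet> \<xi>))))"
  \<comment> \<open>The integrability just proved makes \<open>?G\<close> itself a majorant, because
    the Gaussian is at most 1.\<close>
  proof (rule integral_dominated_convergence[where w = ?G])
    have "(\<lambda>k. ?G \<xi> * gaussian (?e k *\<^sub>R \<xi>)) \<longlonglongrightarrow> ?G \<xi>" for \<xi>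
      using tendsto_mult_left[OF gl, of "?G \<xi>" \<xi>] by simp
    then show "AE \<xi> in lborel. (\<lambda>k. complex_of_real (?G \<xi> * gaussian (?e k *\<^sub>R \<xi>)) * cis (- (2 * pi * (x \<bullet> \<xi>))))
      \<longlonglongrightarrow> complex_of_real (?G \<xi>) * cis (- (2 * pi * (x \<bullet> \<xi>)))"
      by (intro always_eventually allI tendsto_mult_right tendsto_of_real)
    show "AE \<xi> in lborel. norm (complex_of_real (?G \<xi> * gaussian (?e k *\<^sub>R \<xi>)) * cis (- (2 * pi * (x \<bullet> \<xi>)))) \<le> ?G \<xi>" for k
      using nonneg mult_left_le[OF gaussian_bounds(2) nonneg]
      by (intro always_eventually allI) (simp add: norm_mult abs_mult abs_of_pos[OF gaussian_bounds(1)])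
  qed (use int in simp_all)
  moreover have "(\<lambda>k. LINT \<xi>|lborel. complex_of_real (?G \<xi> * gaussian (?e k *\<^sub>R \<xi>)) * cis (- (2 * pi * (x \<bullet> \<xi>))))
      \<longlonglongrightarrow> of_real (g (- x))"
    unfolding reg by (intro tendsto_of_real lim)
  ultimately show "fourier ?G x = of_real (g (- x))"
    by (subst fourier_eq_lborel) (auto intro: LIMSEQ_unique)
qed

section \<open>Autocorrelation of a compact set\<close>

text \<open>The measure of the overlap of S with S - x when S is measurable, that is, the
  convolution of the indicators of S and - S.\<close>

definition autocorr :: "'a::euclidean_space set \<Rightarrow> 'a \<Rightarrow> real" where
  "autocorr S x = (LINT y|lborel. indicator S y * indicator S (y + x))"

lemma integrable_indicator_compact:
  "compact S \<Longrightarrow> integrable lborel (indicator S :: 'a::euclidean_space \<Rightarrow> real)"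
  by (rule integrable_real_indicator[OF _ emeasure_compact_finite]) (simp_all add: borel_compact)

lemma integrable_mult_indicator_bounded:
  fixes S :: "'a::euclidean_space set" and h :: "'a \<Rightarrow> real"
  assumes "compact S" and [measurable]: "h \<in> borel_measurable borel" and "\<And>y. \<bar>h y\<bar> \<le> 1"
  shows "integrable lborel (\<lambda>y. indicator S y * h y)"
proof -
  have [measurable]: "S \<in> sets borel" using assms(1) by (rule borel_compact)
  show ?thesis
    by (rule Bochner_Integration.integrable_bound[OF integrable_indicator_compact[OF assms(1)]])
       (use assms(3) in \<open>auto simp: indicator_def\<close>)
qed

lemma autocorr_bounds:
  assumes S: "compact S"
  shows "0 \<le> autocorr S x" "autocorr S x \<le> measure lborel S"
proof -
  have [measurable]: "S \<in> sets borel" using S by (rule borel_compact)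
  show "0 \<le> autocorr S x"
    unfolding autocorr_def by (rule Bochner_Integration.integral_nonneg) simp
  have "autocorr S x \<le> (LINT y|lborel. indicator S y)"
    unfolding autocorr_def
    by (intro integral_mono integrable_indicator_compact integrable_mult_indicator_bounded S)
       (auto simp: indicator_def)
  then show "autocorr S x \<le> measure lborel S" by simp
qed

lemma autocorr_0: "autocorr S 0 = measure lborel S"
  unfolding autocorr_def by (simp flip: indicator_inter_arith)

text \<open>Replacing y by x + y swaps the two indicators.\<close>

lemma autocorr_minus:
  assumes "compact S"
  shows "autocorr S (- x) = autocorr S x"
proof -
  have [measurable]: "S \<in> sets borel" using assms by (rule borel_compact)
  have "autocorr S (- x) = \<bar>1\<bar> ^ DIM('a) *\<^sub>R (LINT y|lborel. indicator S (x + 1 *\<^sub>R y) * indicator S (x + 1 *\<^sub>R y + - x))"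
    unfolding autocorr_def by (rule lborel_integral_affine) simp_all
  then show ?thesis
    by (simp add: autocorr_def mult.commute add.commute)
qed

lemma autocorr_eq_0:
  assumes "x \<notin> {a - b | a b. a \<in> S \<and> b \<in> S}"
  shows "autocorr S x = 0"
proof -
  have "indicator S y * indicator S (y + x) = (0::real)" for y
  proof (rule ccontr)
    assume "indicator S y * indicator S (y + x) \<noteq> (0::real)"
    then have "y \<in> S" "y + x \<in> S"
      by (auto simp: indicator_def split: if_splits)
    moreover have "x = (y + x) - y" by simp
    ultimately show False using assms by blast
  qed
  then show ?thesis by (simp only: autocorr_def integral_zero)
qed

text \<open>The second indicator is replaced by continuous functions that converge to it in L1. The
  resulting error is uniform in x by translation invariance, and uniform limits preserve continuity.
  Empty S is treated apart because \<open>infdist\<close> to it is 0 by convention.\<close>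

lemma continuous_on_autocorr:
  fixes S :: "'a::euclidean_space set"
  assumes S: "compact S"
  shows "continuous_on A (autocorr S)"
proof (cases "S = {}")
  case True
  then show ?thesis by (simp add: autocorr_def[abs_def])
next
  case ne: False
  have [measurable]: "S \<in> sets borel" using S by (rule borel_compact)
  \<comment> \<open>Each \<open>\<phi> k\<close> is 1 on S and 0 from distance 1 / (k + 1) on. With
    \<open>Suc k\<close> in place of k, all of them vanish outside the compact set K below, whose
    indicator is the common majorant.\<close>
  define \<phi> where "\<phi> k y = max 0 (1 - real (Suc k) * infdist y S)" for k y
  have \<phi>: "0 \<le> \<phi> k y" "\<phi> k y \<le> 1" for k y
    by (auto simp: \<phi>_def infdist_nonneg)
  have \<phi>c: "continuous_on UNIV (\<phi> k)" for k
    unfolding \<phi>_def[abs_def] by (intro continuous_intros)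
  then have [measurable]: "\<phi> k \<in> borel_measurable borel" for k
    by (rule borel_measurable_continuous_onI)
  define K where "K = {y. infdist y S \<le> 1}"
  have K: "compact K"
    unfolding K_def by (rule compact_infdist_le[OF ne S]) simp
  have bound: "\<bar>\<phi> k y - indicator S y\<bar> \<le> indicator K y" for k y
  proof (cases "y \<in> K")
    case True
    then show ?thesis using \<phi>[of k y] by (auto simp: indicator_def)
  next
    case False
    then have "1 < infdist y S" by (simp add: K_def)
    moreover from this have "1 * 1 \<le> real (Suc k) * infdist y S"
      by (intro mult_mono) auto
    moreover from calculation have "y \<notin> S" by auto
    ultimately show ?thesis using False by (simp add: \<phi>_def)
  qed
  have int: "integrable lborel (\<lambda>y. \<bar>\<phi> k y - indicator S y\<bar>)" for k
    by (rule Bochner_Integration.integrable_bound[OF integrable_indicator_compact[OF K]])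
       (use bound in auto)
  have L1: "(\<lambda>k. LINT y|lborel. \<bar>\<phi> k y - indicator S y\<bar>) \<longlonglongrightarrow> (LINT y::'a|lborel. 0)"
  proof (rule integral_dominated_convergence[where w = "indicator K"])
    have "(\<lambda>k. \<phi> k y) \<longlonglongrightarrow> indicator S y" for y
    proof (cases "y \<in> S")
      case True
      then show ?thesis by (simp add: \<phi>_def)
    next
      case False
      then have pos: "infdist y S > 0"
        using S ne by (metis compact_imp_closed in_closed_iff_infdist_zero infdist_nonneg less_eq_real_def)
      obtain N where N: "inverse (infdist y S) < real N"
        using reals_Archimedean2 by blast
      have "\<phi> k y = 0" if "k \<ge> N" for k
      proof -
        have "inverse (infdist y S) \<le> real (Suc k)" using N that by simp
        then have "1 \<le> real (Suc k) * infdist y S" using pos by (simp add: field_simps)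
        then show ?thesis by (simp add: \<phi>_def)
      qed
      then have "eventually (\<lambda>k. \<phi> k y = 0) sequentially"
        by (auto simp: eventually_sequentially)
      then show ?thesis using False by (simp add: tendsto_eventually)
    qed
    then have "(\<lambda>k. \<bar>\<phi> k y - indicator S y\<bar>) \<longlonglongrightarrow> \<bar>indicator S y - indicator S y\<bar>" for y
      by (intro tendsto_intros)
    then show "AE y in lborel. (\<lambda>k. \<bar>\<phi> k y - indicator S y\<bar>) \<longlonglongrightarrow> 0"
      by simp
    show "integrable lborel (indicator K :: 'a \<Rightarrow> real)"
      by (rule integrable_indicator_compact[OF K])
    show "AE y in lborel. norm \<bar>\<phi> k y - indicator S y\<bar> \<le> indicator K y" for k
      using bound by auto
  qed simp_all
  define g where "g k x = (LINT y|lborel. indicator S y * \<phi> k (y + x))" for k x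
  have gc: "continuous_on UNIV (g k)" for k
  proof -
    have "(\<lambda>n. g k (X n)) \<longlonglongrightarrow> g k x" if X: "X \<longlonglongrightarrow> x" for X x
      unfolding g_def
    proof (rule integral_dominated_convergence[where w = "indicator S"])
      have "(\<lambda>n. \<phi> k (y + X n)) \<longlonglongrightarrow> \<phi> k (y + x)" for y
        by (rule continuous_on_tendsto_compose[OF \<phi>c]) (auto intro!: tendsto_intros X)
      then show "AE y in lborel. (\<lambda>n. indicator S y * \<phi> k (y + X n)) \<longlonglongrightarrow> indicator S y * \<phi> k (y + x)"
        by (intro always_eventually allI tendsto_mult_left)
      show "integrable lborel (indicator S :: 'a \<Rightarrow> real)"
        by (rule integrable_indicator_compact[OF S])
      show "AE y in lborel. norm (indicator S y * \<phi> k (y + X n)) \<le> indicator S y" for n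
        using \<phi> by (auto simp: indicator_def)
    qed simp_all
    then show ?thesis
      by (simp add: continuous_on_sequentially o_def)
  qed
  \<comment> \<open>The factor \<open>indicator S y\<close> is at most 1, and a translation removes
    x from the remaining integral, so the bound is independent of x.\<close>
  have close: "\<bar>g k x - autocorr S x\<bar> \<le> (LINT y|lborel. \<bar>\<phi> k y - indicator S y\<bar>)" for k x
  proof -
    have i: "integrable lborel (\<lambda>y. \<bar>\<phi> k (x + 1 *\<^sub>R y) - indicator S (x + 1 *\<^sub>R y)\<bar>)"
      using int by (subst lborel_integrable_affine_iff) simp_all
    have i1: "integrable lborel (\<lambda>y. indicator S y * \<phi> k (y + x))"
      "integrable lborel (\<lambda>y. indicator S y * indicator S (y + x) :: real)"
      by (intro integrable_mult_indicator_bounded S; use \<phi> in \<open>simp add: indicator_def\<close>)+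
    have "g k x - autocorr S x = (LINT y|lborel. indicator S y * \<phi> k (y + x) - indicator S y * indicator S (y + x))"
      unfolding g_def autocorr_def using i1 by simp
    also have "\<bar>\<dots>\<bar> \<le> (LINT y|lborel. \<bar>indicator S y * \<phi> k (y + x) - indicator S y * indicator S (y + x)\<bar>)"
      by (rule integral_abs_bound)
    also have "\<dots> \<le> (LINT y|lborel. \<bar>\<phi> k (x + 1 *\<^sub>R y) - indicator S (x + 1 *\<^sub>R y)\<bar>)"
      by (rule integral_mono[OF integrable_abs[OF Bochner_Integration.integrable_diff[OF i1]] i])
         (auto simp: indicator_def add.commute)
    also have "\<dots> = (LINT y|lborel. \<bar>\<phi> k y - indicator S y\<bar>)"
      using lborel_integral_affine[of "\<lambda>y. \<bar>\<phi> k y - indicator S y\<bar>" 1 x] by simp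
    finally show ?thesis .
  qed
  have "uniform_limit UNIV g (autocorr S) sequentially"
  proof (rule uniform_limitI)
    fix e :: real assume "e > 0"
    with L1 have "eventually (\<lambda>k. (LINT y|lborel. \<bar>\<phi> k y - indicator S y\<bar>) < e) sequentially"
      by (intro order_tendstoD) auto
    then show "eventually (\<lambda>k. \<forall>x\<in>UNIV. dist (g k x) (autocorr S x) < e) sequentially"
      by eventually_elim (use close in \<open>auto simp: dist_real_def intro: le_less_trans\<close>)
  qed
  then have "continuous_on UNIV (autocorr S)"
    by (rule uniform_limit_theorem[rotated]) (auto simp: gc)
  then show ?thesis by (rule continuous_on_subset) simp
qed

lemma borel_measurable_autocorr [measurable]:
  "compact S \<Longrightarrow> autocorr S \<in> borel_measurable borel"
  by (intro borel_measurable_continuous_onI continuous_on_autocorr)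

text \<open>It is bounded by the measure of S and vanishes outside the compact set S - S.\<close>

lemma integrable_autocorr:
  assumes S: "compact S"
  shows "integrable lborel (autocorr S)"
proof (rule Bochner_Integration.integrable_bound)
  let ?D = "{a - b | a b. a \<in> S \<and> b \<in> S}"
  have D: "compact ?D" using compact_differences[OF S S] .
  show "integrable lborel (\<lambda>x. measure lborel S * indicator ?D x)"
    using integrable_indicator_compact[OF D] by simp
  show "AE x in lborel. norm (autocorr S x) \<le> norm (measure lborel S * indicator ?D x)"
    using autocorr_bounds[OF S] autocorr_eq_0[of _ S]
    by (intro always_eventually allI) (auto simp: indicator_def)
qed (use S in simp)

text \<open>Writing x = (y + x) - y splits the phase into a conjugate factor in y and a factor in y
  + x. By translation invariance the inner integral is then the transform of the indicator, whatever
  y is.\<close>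

lemma fourier_autocorr:
  assumes S: "compact S"
  shows "fourier (autocorr S) \<xi> = of_real ((cmod (fourier (indicator S) \<xi>))\<^sup>2)"
proof -
  have [measurable]: "S \<in> sets borel" using S by (rule borel_compact)
  let ?e = "\<lambda>x. cis (- (2 * pi * (\<xi> \<bullet> x)))"
  let ?F = "fourier (indicator S) \<xi>"
  let ?k = "\<lambda>y x. complex_of_real (indicator S y * indicator S (y + x)) * ?e x"
  have i1: "integrable lborel (\<lambda>x. indicator S (y + 1 *\<^sub>R x) :: real)" for y
    using integrable_indicator_compact[OF S] by (subst lborel_integrable_affine_iff) simp_all
  have "integrable (lborel \<Otimes>\<^sub>M lborel) (\<lambda>(y, x). indicator S y * indicator S (y + x) :: real)"
  proof (rule lborel_pair.Fubini_integrable)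
    \<comment> \<open>The inner integral is the same finite constant for every y, so the outer one
      is finite and Fubini applies.\<close>
    have "(LINT x|lborel. indicator S (y + x) :: real) = measure lborel S" for y
      using lborel_integral_affine[of "indicator S :: _ \<Rightarrow> real" 1 y] by simp
    then show "integrable lborel (\<lambda>y. LINT x|lborel. norm ((\<lambda>(y, x). indicator S y * indicator S (y + x) :: real) (y, x)))"
      using integrable_indicator_compact[OF S] by (simp add: abs_mult)
  qed (use i1 in auto)
  then have "integrable (lborel \<Otimes>\<^sub>M lborel)
      (\<lambda>p. complex_of_real (indicator S (fst p) * indicator S (fst p + snd p)) * ?e (snd p))"
    by (subst integrable_mult_cis_iff) (auto simp: case_prod_beta')
  then have int: "integrable (lborel \<Otimes>\<^sub>M lborel) (case_prod ?k)"
    by (simp add: case_prod_beta')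
  have "fourier (autocorr S) \<xi> = (LINT x|lborel. LINT y|lborel. ?k y x)"
    using S by (subst fourier_eq_lborel) (simp_all add: autocorr_def flip: integral_complex_of_real)
  also have "\<dots> = (LINT y|lborel. LINT x|lborel. ?k y x)"
    by (rule lborel_pair.Fubini_integral[OF int])
  also have "\<dots> = (LINT y|lborel. cnj (of_real (indicator S y) * ?e y) * ?F)"
  proof (rule Bochner_Integration.integral_cong[OF refl])
    fix y
    have "?F = (LINT x|lborel. of_real (indicator S (y + x)) * ?e (y + x))"
      using lborel_integral_affine[of "\<lambda>x. complex_of_real (indicator S x) * ?e x" 1 y]
      by (simp add: fourier_eq_lborel)
    then have "cnj (of_real (indicator S y) * ?e y) * ?F
        = (LINT x|lborel. cnj (of_real (indicator S y) * ?e y) * (of_real (indicator S (y + x)) * ?e (y + x)))"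
      by (simp only: integral_mult_right_zero)
    also have "\<dots> = (LINT x|lborel. ?k y x)"
    proof (rule Bochner_Integration.integral_cong[OF refl])
      fix x
      have "cnj (?e y) * ?e (y + x) = ?e x"
        by (simp add: cis_cnj cis_mult inner_add_right algebra_simps)
      then show "cnj (of_real (indicator S y) * ?e y) * (of_real (indicator S (y + x)) * ?e (y + x)) = ?k y x"
        by (simp add: mult_ac)
    qed
    finally show "(LINT x|lborel. ?k y x) = cnj (of_real (indicator S y) * ?e y) * ?F" ..
  qed
  also have "\<dots> = cnj ?F * ?F"
  proof -
    have "(LINT y|lborel. cnj (of_real (indicator S y) * ?e y)) = cnj ?F"
      unfolding fourier_eq_lborel[OF borel_measurable_indicator[OF \<open>S \<in> sets borel\<close>]]
      by (rule Bochner_Integration.integral_cnj)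
    then show ?thesis by (simp only: integral_mult_left_zero)
  qed
  finally show ?thesis
    using complex_norm_square[of ?F] by (simp add: mult.commute)
qed

section \<open>The Cohn--Elkies class\<close>

lemma acceptable_iff_lborel:
  "acceptable f \<longleftrightarrow> (\<forall>x. f (- x) = f x) \<and> continuous_on UNIV f \<and>
     integrable lborel f \<and> integrable lborel (fourier f)"
  unfolding acceptable_def
  by (auto simp: integrable_completion borel_measurable_continuous_onI)

text \<open>Otherwise the origin would satisfy norm 0 \<ge> r, forcing f(0) \<le> 0.\<close>

lemma nonpos_radius_pos:
  fixes f :: "'a::euclidean_space \<Rightarrow> real"
  assumes "f 0 > 0" "\<forall>x. norm x \<ge> r \<longrightarrow> f x \<le> 0"
  shows "r > 0"
  using assms by (metis linorder_not_le norm_zero)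

lemma
  fixes f :: "'a::euclidean_space \<Rightarrow> real"
  assumes "f 0 > 0"
  shows bdd_below_nonpos_radii: "bdd_below {r. \<forall>x. norm x \<ge> r \<longrightarrow> f x \<le> 0}"
    and r_of_le: "\<forall>x. norm x \<ge> r \<longrightarrow> f x \<le> 0 \<Longrightarrow> r_of f \<le> r"
proof -
  show bdd: "bdd_below {r. \<forall>x. norm x \<ge> r \<longrightarrow> f x \<le> 0}"
    by (rule bdd_belowI[of _ 0]) (use nonpos_radius_pos[of f, OF assms] in fastforce)
  show "r_of f \<le> r" if "\<forall>x. norm x \<ge> r \<longrightarrow> f x \<le> 0"
    unfolding r_of_def by (rule cInf_lower[OF _ bdd]) (use that in simp)
qed

lemma r_of_nonneg:
  assumes "f \<in> CE_class"
  shows "0 \<le> r_of f"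
  unfolding r_of_def
proof (rule cInf_greatest)
  show "{r. \<forall>x. norm x \<ge> r \<longrightarrow> f x \<le> 0} \<noteq> {}"
    using assms by (auto simp: CE_class_def)
next
  fix r assume "r \<in> {r. \<forall>x. norm x \<ge> r \<longrightarrow> f x \<le> 0}"
  then have "\<forall>x. norm x \<ge> r \<longrightarrow> f x \<le> 0" by simp
  then have "0 < r"
    using assms by (intro nonpos_radius_pos[of f r]) (simp_all add: CE_class_def)
  then show "0 \<le> r" by simp
qed

lemma R_dim_le:
  fixes f :: "'a::euclidean_space \<Rightarrow> real"
  assumes "f \<in> CE_class"
  shows "R_dim TYPE('a) \<le> r_of f"
  unfolding R_dim_def
  by (rule cInf_lower) (use assms r_of_nonneg in \<open>auto intro!: bdd_belowI[of _ 0]\<close>)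

text \<open>The infimum is attained: strictly beyond it the sign follows from the definition, and on
  the sphere itself from continuity, approaching from outside.\<close>

lemma nonpos_beyond_r_of:
  fixes f :: "'a::euclidean_space \<Rightarrow> real"
  assumes f: "f \<in> CE_class" and x: "norm x \<ge> r_of f"
  shows "f x \<le> 0"
proof -
  let ?A = "{r. \<forall>x. norm x \<ge> r \<longrightarrow> f x \<le> 0}"
  have f0: "f 0 > 0" and cont: "continuous_on UNIV f" and ne: "?A \<noteq> {}"
    using f by (auto simp: CE_class_def acceptable_def)
  have strict: "f y \<le> 0" if y: "norm y > r_of f" for y
  proof -
    obtain s where "s \<in> ?A" "s < norm y"
      using y ne bdd_below_nonpos_radii[of f, OF f0] unfolding r_of_def by (meson cInf_lessD)
    then show ?thesis by simp
  qed
  show ?thesis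
  proof (cases "x = 0")
    \<comment> \<open>Scaling fixes the origin, so it is approached along a basis vector
      instead.\<close>
    case True
    then have "r_of f = 0" using x r_of_nonneg[OF f] by simp
    obtain b :: 'a where b: "b \<in> Basis" using nonempty_Basis by blast
    have "f (inverse (real (Suc k)) *\<^sub>R b) \<le> 0" for k
      using b \<open>r_of f = 0\<close> by (intro strict) simp
    moreover have "(\<lambda>k. f (inverse (real (Suc k)) *\<^sub>R b)) \<longlonglongrightarrow> f (0 *\<^sub>R b)"
      by (intro continuous_on_tendsto_compose[OF cont] tendsto_intros LIMSEQ_inverse_real_of_nat) simp_all
    ultimately show ?thesis
      using True by (metis (no_types, lifting) LIMSEQ_le_const2 scaleR_zero_left)
  next
    case False
    have "f ((1 + inverse (real (Suc k))) *\<^sub>R x) \<le> 0" for k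
    proof (rule strict)
      have "norm x < (1 + inverse (real (Suc k))) * norm x"
        using False by (simp add: distrib_right)
      with x show "norm ((1 + inverse (real (Suc k))) *\<^sub>R x) > r_of f" by simp
    qed
    moreover have "(\<lambda>k. f ((1 + inverse (real (Suc k))) *\<^sub>R x)) \<longlonglongrightarrow> f ((1 + 0) *\<^sub>R x)"
      by (intro continuous_on_tendsto_compose[OF cont] tendsto_intros LIMSEQ_inverse_real_of_nat) simp_all
    ultimately show ?thesis
      by (metis (no_types, lifting) LIMSEQ_le_const2 add_0_right scaleR_one)
  qed
qed

text \<open>Dilating by the \<open>n\<close>-th root of \<open>fourier h 0 / h 0 > 1\<close> restores the normalisation
  \<open>fourier h 0 = h 0\<close> and shrinks the radius by that factor.\<close>

lemma R_dim_less:
  fixes h :: "'a::euclidean_space \<Rightarrow> real"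
  assumes h: "acceptable h" and pos: "\<And>\<xi>. fourier h \<xi> \<in> \<real> \<and> 0 \<le> Re (fourier h \<xi>)"
    and h0: "0 < h 0" and gain: "h 0 < Re (fourier h 0)"
    and nonpos: "\<And>x. norm x \<ge> r \<Longrightarrow> h x \<le> 0"
  shows "R_dim TYPE('a) < r"
proof -
  have r: "r > 0" by (rule nonpos_radius_pos[of h, OF h0]) (use nonpos in blast)
  let ?q = "Re (fourier h 0) / h 0"
  define c where "c = root DIM('a) ?q"
  have q: "?q > 1" using h0 gain by simp
  have c: "c > 1" using q by (simp add: c_def)
  have cq: "c ^ DIM('a) = ?q" unfolding c_def using q by (intro real_root_pow_pos2) auto
  define k where "k x = h (c *\<^sub>R x)" for x
  have even: "h (- x) = h x" and cont: "continuous_on UNIV h" and int: "integrable lborel h"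
    and intF: "integrable lborel (fourier h)" for x
    using h unfolding acceptable_iff_lborel by auto
  have [measurable]: "h \<in> borel_measurable borel"
    using cont by (rule borel_measurable_continuous_onI)
  \<comment> \<open>The dilation keeps the value at the origin and divides the transform there by
    c^n = \<open>?q\<close>, which makes the two equal.\<close>
  have Fk: "fourier k \<xi> = fourier h (\<xi> /\<^sub>R c) / of_real (c ^ DIM('a))" for \<xi>
    unfolding k_def using c by (subst fourier_scale) auto
  have "acceptable k"
    unfolding acceptable_iff_lborel
  proof (intro conjI allI)
    show "k (- x) = k x" for x using even by (simp add: k_def)
    show "continuous_on UNIV k"
      unfolding k_def by (intro continuous_on_compose2[OF cont] continuous_intros) auto
    have "integrable lborel (\<lambda>x. h (0 + c *\<^sub>R x))"
      using int c by (subst lborel_integrable_affine_iff) auto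
    then show "integrable lborel k" by (simp add: k_def[abs_def])
    have "integrable lborel (\<lambda>\<xi>. fourier h (0 + inverse c *\<^sub>R \<xi>))"
      using intF c by (subst lborel_integrable_affine_iff) auto
    then show "integrable lborel (fourier k)" unfolding Fk[abs_def] by simp
  qed
  moreover have "complex_of_real (k 0) = fourier k 0"
  proof -
    have "fourier h 0 = of_real (Re (fourier h 0))" using pos[of 0] by (simp add: of_real_Re)
    then have "fourier k 0 = of_real (Re (fourier h 0) / c ^ DIM('a))"
      unfolding Fk by (metis of_real_divide scaleR_zero_right)
    also have "Re (fourier h 0) / c ^ DIM('a) = k 0"
      unfolding cq using h0 gain by (simp add: k_def)
    finally show ?thesis ..
  qed
  moreover have "fourier k \<xi> \<in> \<real> \<and> Re (fourier k \<xi>) \<ge> 0" for \<xi>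
    using pos[of "\<xi> /\<^sub>R c"] c unfolding Fk by (auto simp: Re_divide_of_real simp del: of_real_power)
  moreover have k0: "k 0 > 0" using h0 by (simp add: k_def)
  moreover have knp: "\<forall>x. norm x \<ge> r / c \<longrightarrow> k x \<le> 0"
    using c nonpos by (simp add: k_def field_simps)
  moreover have "r / c > 0" using r c by simp
  ultimately have "k \<in> CE_class"
    unfolding CE_class_def by blast
  then have "R_dim TYPE('a) \<le> r_of k" by (rule R_dim_le)
  also have "\<dots> \<le> r / c" using k0 knp by (rule r_of_le)
  also have "\<dots> < r" using r c by (simp add: divide_less_eq)
  finally show ?thesis .
qed

text \<open>The minimum is attained unless K is empty, when any constant serves. The bound is the
  room available for a perturbation.\<close>

lemma compact_positive_lower_bound:
  fixes p :: "'a::topological_space \<Rightarrow> real"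
  assumes "compact K" "continuous_on K p" "\<And>x. x \<in> K \<Longrightarrow> p x > 0"
  shows "\<exists>\<delta>>0. \<forall>x\<in>K. \<delta> \<le> p x"
proof (cases "K = {}")
  case True
  then show ?thesis by (auto intro: exI[of _ 1])
next
  case False
  then obtain x where "x \<in> K" "\<forall>y\<in>K. p x \<le> p y"
    using continuous_attains_inf[OF assms(1) _ assms(2)] by blast
  then show ?thesis using assms(3) by blast
qed

section \<open>The two perturbation arguments\<close>

theorem theorem1p2:
  fixes f :: "'a::euclidean_space \<Rightarrow> real" and S :: "'a set"
  assumes "cohn_elkies f" and "radial f"
    and "compact S" and "measure lebesgue S > 1"
  shows "(\<exists>z \<in> {a - b | a b. a \<in> S \<and> b \<in> S}. norm z \<ge> r_of f \<and> f z = 0)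
       \<and> (\<exists>z' \<in> {a - b | a b. a \<in> S \<and> b \<in> S}. fourier f z' = 0)"
proof -
  let ?D = "{a - b | a b. a \<in> S \<and> b \<in> S}"
  note S = \<open>compact S\<close>
  have D: "compact ?D" by (rule compact_differences[OF S S])
  define m where "m = measure lborel S"
  have m: "m > 1" using assms(4) S by (simp add: m_def borel_compact)
  have f: "f \<in> CE_class" and R: "r_of f = R_dim TYPE('a)"
    using assms(1) by (auto simp: cohn_elkies_def)
  have even: "f (- x) = f x" and cont: "continuous_on UNIV f" and int: "integrable lborel f"
    and intF: "integrable lborel (fourier f)" and f0: "f 0 > 0" and ff0: "fourier f 0 = f 0"
    and real: "fourier f \<xi> \<in> \<real>" and nonneg: "Re (fourier f \<xi>) \<ge> 0" for x \<xi>
    using f by (auto simp: CE_class_def acceptable_iff_lborel)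
  have [measurable]: "f \<in> borel_measurable borel"
    using cont by (rule borel_measurable_continuous_onI)
  let ?g = "autocorr S"
  define G where "G \<xi> = Re (fourier ?g \<xi>)" for \<xi>
  have [measurable]: "?g \<in> borel_measurable borel"
    using S by (rule borel_measurable_autocorr)
  have [measurable]: "G \<in> borel_measurable borel"
    unfolding G_def by measurable
  have FG: "fourier ?g \<xi> = of_real (G \<xi>)" and G_nonneg: "0 \<le> G \<xi>" for \<xi>
    by (simp_all add: G_def fourier_autocorr[OF S])
  have g: "0 \<le> ?g x" "?g x \<le> m" for x
    using autocorr_bounds[OF S] by (auto simp: m_def)
  have g_abs: "\<bar>?g x\<bar> \<le> m" for x using g by simp
  have intg: "integrable lborel ?g" by (rule integrable_autocorr[OF S])
  \<comment> \<open>At the origin the transform of the indicator is the measure of S.\<close>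
  have G0: "G 0 = m\<^sup>2"
    unfolding G_def fourier_autocorr[OF S]
    using S by (subst fourier_0) (simp_all add: borel_compact m_def borel_measurable_indicator)
  have intG: "integrable lborel G"
    unfolding G_def
    by (rule integrable_fourier_if_nonneg[OF continuous_on_autocorr[OF S] intg g_abs])
       (use FG G_nonneg in auto)
  have inv: "fourier G x = of_real (?g x)" for x
  proof -
    have "fourier (\<lambda>\<xi>. Re (fourier ?g \<xi>)) x = of_real (?g (- x))"
      by (rule fourier_inversion_if_nonneg[OF continuous_on_autocorr[OF S] intg g_abs])
         (use FG G_nonneg in auto)
    then show ?thesis
      by (simp add: G_def[abs_def] autocorr_minus[OF S])
  qed
  have contG: "continuous_on UNIV G"
    unfolding G_def by (intro continuous_intros continuous_on_fourier intg) simp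
  \<comment> \<open>Here measure greater than 1 enters: the transform of g at 0, m^2, exceeds g(0) =
    m.\<close>
  have "m * 1 < m * m" using m by (intro mult_strict_left_mono) auto
  then have mm: "m < m\<^sup>2" by (simp add: power2_eq_square)
  have "\<exists>z\<in>?D. norm z \<ge> r_of f \<and> f z = 0"
  proof (rule ccontr)
    assume contra: "\<not> ?thesis"
    \<comment> \<open>On this compact set f is nonpositive and, by assumption, without zeros, hence
      bounded away from 0.\<close>
    let ?K = "?D \<inter> {z. norm z \<ge> r_of f}"
    have "compact ?K"
      by (intro compact_Int_closed D closed_Collect_le continuous_intros)
    moreover have "continuous_on ?K (\<lambda>z. - f z)"
      by (intro continuous_on_minus continuous_on_subset[OF cont]) simp
    moreover have "- f z > 0" if "z \<in> ?K" for z
      using that nonpos_beyond_r_of[OF f, of z] contra by force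
    ultimately have "\<exists>\<delta>>0. \<forall>z\<in>?K. \<delta> \<le> - f z"
      by (rule compact_positive_lower_bound)
    then obtain \<delta> where \<delta>: "\<delta> > 0" "\<forall>z\<in>?K. \<delta> \<le> - f z"
      by (elim exE conjE)
    \<comment> \<open>Since g \<le> m, the added term is at most \<delta>, which f can absorb on
      \<open>?K\<close>.\<close>
    define e where "e = \<delta> / m"
    have e: "e > 0" "e * m = \<delta>" using \<delta> m by (auto simp: e_def)
    let ?h = "\<lambda>x. f x + e * ?g x"
    have Fh: "fourier ?h \<xi> = fourier f \<xi> + of_real e * of_real (G \<xi>)" for \<xi>
      by (subst fourier_add_mult) (simp_all add: int intg FG)
    have "R_dim TYPE('a) < r_of f"
    proof (rule R_dim_less[of ?h])
      show "acceptable ?h"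
        unfolding acceptable_iff_lborel Fh[abs_def]
        using even autocorr_minus[OF S] int intg intF intG
        by (auto intro!: continuous_intros cont continuous_on_autocorr[OF S])
      show "fourier ?h \<xi> \<in> \<real> \<and> 0 \<le> Re (fourier ?h \<xi>)" for \<xi>
        unfolding Fh using real[of \<xi>] nonneg[of \<xi>] G_nonneg[of \<xi>] e by auto
      show "0 < ?h 0" using f0 e g[of 0] by (simp add: add_pos_nonneg)
      \<comment> \<open>The two sides are f(0) + e m and f(0) + e m^2.\<close>
      show "?h 0 < Re (fourier ?h 0)"
        unfolding Fh ff0 using e(1) mm by (simp add: autocorr_0 G0 flip: m_def)
      show "?h x \<le> 0" if x: "norm x \<ge> r_of f" for x
      proof (cases "x \<in> ?D")
        case True
        with x have "\<delta> \<le> - f x" by (intro bspec[OF \<delta>(2)]) simp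
        moreover have "e * ?g x \<le> e * m" using e g by (intro mult_left_mono) auto
        ultimately show ?thesis using e by simp
      next
        case False
        then show ?thesis
          using nonpos_beyond_r_of[OF f x] by (simp add: autocorr_eq_0)
      qed
    qed
    with R show False by simp
  qed
  moreover have "\<exists>z'\<in>?D. fourier f z' = 0"
  proof (rule ccontr)
    assume contra: "\<not> ?thesis"
    have "continuous_on ?D (\<lambda>z. Re (fourier f z))"
      by (intro continuous_intros continuous_on_fourier int) simp
    moreover have "Re (fourier f z) > 0" if "z \<in> ?D" for z
    proof -
      have "fourier f z \<noteq> 0" using that contra by blast
      then have "Re (fourier f z) \<noteq> 0"
        using real[of z] by (metis of_real_0 of_real_Re)
      then show ?thesis using nonneg[of z] by simp
    qed
    ultimately have "\<exists>\<delta>>0. \<forall>z\<in>?D. \<delta> \<le> Re (fourier f z)"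
      by (rule compact_positive_lower_bound[OF D])
    then obtain \<delta> where \<delta>: "\<delta> > 0" "\<forall>z\<in>?D. \<delta> \<le> Re (fourier f z)"
      by (elim exE conjE)
    \<comment> \<open>The first bound keeps e g \<le> \<delta>, so the transform stays nonnegative
      on S - S; the second keeps h(0) = f(0) - e m^2 \<ge> f(0) / 2 positive.\<close>
    define e where "e = min (\<delta> / m) (f 0 / (2 * m\<^sup>2))"
    have "e \<le> \<delta> / m" "e \<le> f 0 / (2 * m\<^sup>2)" by (simp_all add: e_def)
    moreover have "e > 0" using \<delta>(1) m f0 by (simp add: e_def)
    ultimately have e: "e > 0" "e * m \<le> \<delta>" "e * m\<^sup>2 \<le> f 0 / 2"
      using m by (simp_all add: field_simps)
    \<comment> \<open>Subtracting the nonnegative G preserves nonpositivity of f, and by inversion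
      lowers the transform by e g, which lives on S - S.\<close>
    let ?h = "\<lambda>x. f x + (- e) * G x"
    have Fh: "fourier ?h \<xi> = fourier f \<xi> + of_real (- e) * of_real (?g \<xi>)" for \<xi>
      by (subst fourier_add_mult) (simp_all add: int intG inv)
    have "R_dim TYPE('a) < r_of f"
    proof (rule R_dim_less[of ?h])
      \<comment> \<open>As g is real, reflecting the argument conjugates its transform, which is
        real as well.\<close>
      have "G (- x) = G x" for x
      proof -
        have "complex_of_real (G (- x)) = cnj (of_real (G x))"
          unfolding FG[symmetric]
          by (simp add: fourier_eq_lborel cis_cnj flip: Bochner_Integration.integral_cnj)
        then show ?thesis by simp
      qed
      then show "acceptable ?h"
        unfolding acceptable_iff_lborel Fh[abs_def]
        using even int intg intF intG
        by (auto intro!: continuous_intros cont contG)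
      show "fourier ?h \<xi> \<in> \<real> \<and> 0 \<le> Re (fourier ?h \<xi>)" for \<xi>
      proof
        show "fourier ?h \<xi> \<in> \<real>" unfolding Fh using real[of \<xi>] by simp
        have "e * ?g \<xi> \<le> Re (fourier f \<xi>)"
        proof (cases "\<xi> \<in> ?D")
          case True
          have "e * ?g \<xi> \<le> e * m" using e g by (intro mult_left_mono) auto
          then show ?thesis using e(2) bspec[OF \<delta>(2) True] by linarith
        next
          case False
          then show ?thesis using nonneg by (simp add: autocorr_eq_0)
        qed
        then show "0 \<le> Re (fourier ?h \<xi>)" unfolding Fh by simp
      qed
      show "0 < ?h 0" using f0 e by (simp add: G0)
      \<comment> \<open>Now the value at 0 drops by e m^2 but the transform at 0 only by e
        m.\<close>
      have "e * m < e * m\<^sup>2" using e mm by simp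
      then show "?h 0 < Re (fourier ?h 0)"
        unfolding Fh ff0 by (simp add: autocorr_0 G0 flip: m_def)
      show "?h x \<le> 0" if x: "norm x \<ge> r_of f" for x
        using nonpos_beyond_r_of[OF f x] mult_nonneg_nonneg[OF less_imp_le[OF e(1)] G_nonneg[of x]] by simp
    qed
    with R show False by simp
  qed
  ultimately show ?thesis ..
qed

end
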